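(* For each fixed integer $d>1$ there exists a constant $c_d>0$ such that the following holds. Let $r=r(n)>0$ satisfy $r^{3d-1} > c_d \frac{\log n}{n}$. Then asymptotically almost surely (i.e., with probability tending to $1$ as $n\to\infty$) the random geometric graph $\mathcal{G}_d(n,r)$ has cop number $c(\mathcal{G}_d(n,r))=1$.
   Context: The game of Cops and Robbers is played on a finite simple undirected graph $G$ by $k\ge 1$ cops and one robber. The cops first occupy any $k$ vertices (several cops may share a vertex); then the robber chooses a vertex; then the cops and the robber move in alternate rounds, where in a move each player either stays at its current vertex or moves along an edge to an adjacent vertex. Both sides always know all current positions. The cops win if at some point a cop occupies the same vertex as the robber; otherwise the robber wins. The cop number $c(G)$ is the minimum $k$ such that $k$ cops have a winning strategy on $G$. The random geometric graph $\mathcal{G}_d(n,r)$ has vertex set $\{1,\dots,n\}$; the $n$ vertices are assigned points chosen independently and uniformly at random from $[0,1]^d$, and two vertices are adjacent if and only if the Euclidean distance between their points is at most $r$. Here $r=r(n)$ may depend on $n$, and asymptotics are as $n\to\infty$. *)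

theory Defs
  imports "HOL-Probability.Probability"
begin

definition legal_step :: "'v set \<Rightarrow> ('v \<Rightarrow> 'v \<Rightarrow> bool) \<Rightarrow> 'v \<Rightarrow> 'v \<Rightarrow> bool" where
  "legal_step V E u w \<longleftrightarrow> w \<in> V \<and> (w = u \<or> E u w)"

definition robber_walk :: "'v set \<Rightarrow> ('v \<Rightarrow> 'v \<Rightarrow> bool) \<Rightarrow> (nat \<Rightarrow> 'v) \<Rightarrow> bool" where
  "robber_walk V E r \<longleftrightarrow> r 0 \<in> V \<and> (\<forall>t. legal_step V E (r t) (r (Suc t)))"

text \<open>Cop positions at time t (cop i at position c t i, i < k). The cops' strategy
  sigma maps the history of robber positions r 0, ..., r t (the cops' own past positions are
  determined by it) to the new cop positions.\<close>

primrec cop_play :: "(nat \<Rightarrow> 'v) \<Rightarrow> ('v list \<Rightarrow> nat \<Rightarrow> 'v) \<Rightarrow> (nat \<Rightarrow> 'v) \<Rightarrow> nat \<Rightarrow> nat \<Rightarrow> 'v" where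
  "cop_play c0 \<sigma> r 0 = c0"
| "cop_play c0 \<sigma> r (Suc t) = \<sigma> (map r [0..<Suc t])"

text \<open>k cops have a winning strategy: initial positions c0 and a strategy sigma such that for
  every robber play (robber chooses r 0 after seeing c0, and r (t+1) after seeing the cops'
  move to time t+1), all cop moves are legal and at some point a cop shares the robber's vertex
  (either cop at time t meets robber at time t, or a cop moves onto the robber).\<close>

definition cops_win :: "'v set \<Rightarrow> ('v \<Rightarrow> 'v \<Rightarrow> bool) \<Rightarrow> nat \<Rightarrow> bool" where
  "cops_win V E k \<longleftrightarrow>
     (\<exists>c0 \<sigma>. (\<forall>i<k. c0 i \<in> V) \<and>
        (\<forall>r. robber_walk V E r \<longrightarrow>
           (let c = cop_play c0 \<sigma> r in
             (\<forall>t. \<forall>i<k. legal_step V E (c t i) (c (Suc t) i)) \<and>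
             (\<exists>t. \<exists>i<k. c t i = r t \<or> c (Suc t) i = r t))))"

definition cop_number :: "'v set \<Rightarrow> ('v \<Rightarrow> 'v \<Rightarrow> bool) \<Rightarrow> nat" where
  "cop_number V E = (LEAST k. 1 \<le> k \<and> cops_win V E k)"

definition rgg_adj :: "(nat \<Rightarrow> 'a::metric_space) \<Rightarrow> real \<Rightarrow> nat \<Rightarrow> nat \<Rightarrow> bool" where
  "rgg_adj x r i j \<longleftrightarrow> i \<noteq> j \<and> dist (x i) (x j) \<le> r"

definition rgg_space :: "nat \<Rightarrow> (nat \<Rightarrow> real ^ 'd) measure" where
  "rgg_space n = PiM {..<n} (\<lambda>_. uniform_measure lborel (cbox (0::real^'d) One))"

end

theory Submission
  imports Defs
begin

text \<open>Rank the vertices by the distance R of their points from the centre c of the cube. If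
  R > r/2, every r-neighbour of v that is no farther from c than v is also within r of any point
  v + s(z - v) with z within distance of order r of c and s at most of order (r/R)^2. Such points
  are closer to c than v and contain a chain of about R/r disjoint balls of radius of order
  r (r/R)^2, hence fill a volume of order at least r^(3d-1). By the union bound, with high
  probability each v with R > r/2 has a vertex among these points, while the vertices with
  R \<le> r/2 form a clique; so the graph is dismantlable, and one cop wins.\<close>

section \<open>Dismantlable graphs\<close>

text \<open>Loops are added because staying put is a legal move and because folding a graph may
  identify adjacent vertices.\<close>

definition adj_refl :: "('v \<Rightarrow> 'v \<Rightarrow> bool) \<Rightarrow> 'v \<Rightarrow> 'v \<Rightarrow> bool" where
  "adj_refl E u w \<longleftrightarrow> w = u \<or> E u w"

text \<open>Composite of the first \<open>m\<close> foldings. In a dismantling with levels bounded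
  by \<open>M\<close>, the image after \<open>m\<close> stages lies in levels up to
  \<open>M - m\<close>, so the test \<open>g u \<ge> M - m\<close> selects exactly the current top
  level.\<close>

primrec retract :: "('v \<Rightarrow> nat) \<Rightarrow> ('v \<Rightarrow> 'v) \<Rightarrow> nat \<Rightarrow> nat \<Rightarrow> 'v \<Rightarrow> 'v" where
  "retract g p M 0 v = v"
| "retract g p M (Suc m) v =
     (let u = retract g p M m v in if g u \<ge> M - m then p u else u)"

text \<open>A level may hold several vertices: \<open>p v\<close> has to dominate \<open>v\<close>
  among all levels up to and including that of \<open>v\<close>, so that a whole level can be folded
  at once. By \<open>p_less\<close>, \<open>b\<close> is the only vertex of level 0.\<close>

locale dismantlable =
  fixes V :: "'v set" and E :: "'v \<Rightarrow> 'v \<Rightarrow> bool" and g :: "'v \<Rightarrow> nat"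
    and p :: "'v \<Rightarrow> 'v" and b :: 'v
  assumes fin: "finite V" and b: "b \<in> V"
    and sym: "\<And>u w. E u w \<Longrightarrow> E w u"
    and p_in: "\<And>v. v \<in> V \<Longrightarrow> v \<noteq> b \<Longrightarrow> p v \<in> V"
    and p_less: "\<And>v. v \<in> V \<Longrightarrow> v \<noteq> b \<Longrightarrow> g (p v) < g v"
    and g_b: "g b = 0"
    and p_dom: "\<And>v w. v \<in> V \<Longrightarrow> v \<noteq> b \<Longrightarrow> w \<in> V \<Longrightarrow> g w \<le> g v \<Longrightarrow>
                  adj_refl E v w \<Longrightarrow> adj_refl E (p v) w"
begin

lemma adj_refl_sym: "adj_refl E u w \<Longrightarrow> adj_refl E w u"
  using sym by (auto simp: adj_refl_def)

lemma retract_level: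
  assumes "\<And>v. v \<in> V \<Longrightarrow> g v \<le> M" "v \<in> V" "m \<le> M"
  shows "retract g p M m v \<in> V \<and> g (retract g p M m v) \<le> M - m"
  using assms(3)
proof (induction m)
  case 0
  then show ?case using assms by simp
next
  case (Suc m)
  define u where "u = retract g p M m v"
  have u: "u \<in> V" "g u \<le> M - m" using Suc by (auto simp: u_def)
  show ?case
  proof (cases "g u \<ge> M - m")
    case True
    then have "u \<noteq> b" using g_b Suc.prems by auto
    then have "p u \<in> V" "g (p u) < g u" using p_in p_less u by auto
    then show ?thesis using True u by (simp add: u_def[symmetric])
  next
    case False
    then show ?thesis using u by (simp add: u_def[symmetric])
  qed
qed

text \<open>Each stage is a reflexive homomorphism, shown by folding the two endpoints one after the
  other. The intermediate state, with only \<open>v\<close> folded once more, is the second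
  conjunct: a cop's move leads from a stage \<open>Suc m\<close> image to a stage \<open>m\<close>
  image.\<close>

lemma retract_adj:
  assumes "\<And>v. v \<in> V \<Longrightarrow> g v \<le> M" "v \<in> V" "w \<in> V" "m \<le> M" "adj_refl E v w"
  shows "adj_refl E (retract g p M m v) (retract g p M m w)
         \<and> (m < M \<longrightarrow> adj_refl E (retract g p M (Suc m) v) (retract g p M m w))"
  using assms(4)
proof (induction m)
  have step: "adj_refl E (retract g p M (Suc m) v) (retract g p M m w)"
    if "m < M" "adj_refl E (retract g p M m v) (retract g p M m w)" "v \<in> V" "w \<in> V" for m v w
  proof -
    define u where "u = retract g p M m v"
    define x where "x = retract g p M m w"
    have u: "u \<in> V" "g u \<le> M - m" and x: "x \<in> V" "g x \<le> M - m"
      using retract_level[of M _ m] assms(1) that by (auto simp: u_def x_def)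
    show ?thesis
    proof (cases "g u \<ge> M - m")
      case True
      then have "u \<noteq> b" using g_b that by auto
      then have "adj_refl E (p u) x" using p_dom u x that True by (simp add: u_def x_def)
      then show ?thesis using True by (simp add: u_def[symmetric] x_def[symmetric])
    next
      case False
      then show ?thesis using that by (simp add: u_def[symmetric] x_def[symmetric])
    qed
  qed
  {
    case 0
    then show ?case using assms step[of 0 v w] by auto
  next
    case (Suc m)
    have m: "m < M" using Suc by simp
    have *: "adj_refl E (retract g p M (Suc m) v) (retract g p M m w)" using Suc by auto
    define u where "u = retract g p M (Suc m) v"
    define x where "x = retract g p M m w"
    have u: "u \<in> V" "g u \<le> M - Suc m" and x: "x \<in> V" "g x \<le> M - m"
      using retract_level[of M v "Suc m"] retract_level[of M w m] assms Suc.prems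
      by (auto simp: u_def x_def)
    \<comment> \<open>The image \<open>u\<close> of \<open>v\<close> has already been folded and so
      lies no higher than \<open>x\<close>; hence \<open>p_dom\<close> may now be applied to
      \<open>x\<close>.\<close>
    have "adj_refl E (retract g p M (Suc m) w) (retract g p M (Suc m) v)"
    proof (cases "g x \<ge> M - m")
      case True
      then have "x \<noteq> b" using g_b m by auto
      then have "adj_refl E (p x) u"
        using p_dom[of x u] u x True adj_refl_sym[OF *[folded u_def x_def]] by simp
      then show ?thesis using True unfolding u_def[symmetric] by (simp add: x_def[symmetric])
    next
      case False
      then show ?thesis using adj_refl_sym[OF *] by (simp add: x_def[symmetric])
    qed
    then show ?case using step[of "Suc m" v w] assms adj_refl_sym by blast
  }
qed

text \<open>The cop follows the image of the robber under the retraction onto the first levels of the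
  dismantling order, admitting one more level in every round.\<close>

theorem cops_win_1: "cops_win V E 1"
proof -
  define M where "M = Max (g ` V)"
  have M: "\<And>v. v \<in> V \<Longrightarrow> g v \<le> M" using fin by (auto simp: M_def)
  \<comment> \<open>After the robber's position at time \<open>t\<close> the history has length
    \<open>t + 1\<close>, so the stage is \<open>M - t\<close>; truncated subtraction keeps it at 0
    from \<open>t = M\<close> on.\<close>
  define \<sigma> :: "'v list \<Rightarrow> nat \<Rightarrow> 'v" where
    "\<sigma> = (\<lambda>h _. retract g p M (M - (length h - 1)) (last h))"
  define c0 :: "nat \<Rightarrow> 'v" where "c0 = (\<lambda>_. b)"
  have c_Suc: "cop_play c0 \<sigma> r (Suc t) i = retract g p M (M - t) (r t)" for r t i
    by (simp add: \<sigma>_def)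
  show ?thesis
    unfolding cops_win_def
  proof (intro exI[of _ c0] exI[of _ \<sigma>] conjI allI impI)
    show "c0 i \<in> V" for i using b by (simp add: c0_def)
    fix r assume r: "robber_walk V E r"
    have rV: "r t \<in> V" for t
      using r by (cases t) (auto simp: robber_walk_def legal_step_def)
    have radj: "adj_refl E (r t) (r (Suc t))" for t
      using r by (auto simp: robber_walk_def legal_step_def adj_refl_def)
    have "legal_step V E (cop_play c0 \<sigma> r t i) (cop_play c0 \<sigma> r (Suc t) i)" for t i
    proof (cases t)
      case 0
      \<comment> \<open>All \<open>M\<close> stages together send every vertex to level 0, that is
        to \<open>b\<close>, so the first cop move is to stay at \<open>b\<close>.\<close>
      have "retract g p M M (r 0) \<in> V" "g (retract g p M M (r 0)) = 0"
        using retract_level[OF M rV, of M] by auto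
      then have "retract g p M M (r 0) = b"
        using p_less by (metis not_less_zero)
      then show ?thesis using b 0 c_Suc[of r 0 i]
        by (simp add: legal_step_def c0_def del: cop_play.simps(2))
    next
      case (Suc s)
      have "retract g p M (M - t) (r t) \<in> V" using retract_level[OF M rV] by auto
      moreover have "adj_refl E (retract g p M (M - s) (r s)) (retract g p M (M - t) (r t))"
      proof (cases "s < M")
        case True
        then have "M - s = Suc (M - t)" "M - t < M" using Suc by auto
        then show ?thesis
          using retract_adj[OF M rV rV, of "M - t" s t] radj[of s] Suc by (metis diff_le_self)
      next
        case False
        then show ?thesis using radj[of s] Suc by simp
      qed
      ultimately show ?thesis
        using Suc c_Suc by (auto simp: legal_step_def adj_refl_def simp del: cop_play.simps)
    qed
    \<comment> \<open>Stage \<open>M - M = 0\<close> is the identity, so the cop now steps onto the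
      robber.\<close>
    moreover have "cop_play c0 \<sigma> r (Suc M) 0 = r M" using c_Suc[of r M 0] by simp
    ultimately show "let c = cop_play c0 \<sigma> r in
             (\<forall>t. \<forall>i<1. legal_step V E (c t i) (c (Suc t) i)) \<and>
             (\<exists>t. \<exists>i<1. c t i = r t \<or> c (Suc t) i = r t)"
      by (metis zero_less_one)
  qed
qed

end

section \<open>From rankings to cop number one\<close>

lemma cop_number_eq_1: "cops_win V E 1 \<Longrightarrow> cop_number V E = 1"
  unfolding cop_number_def by (intro Least_equality) auto

text \<open>Ties of the real-valued ranking f are harmless: retracting a whole level at once is still a
  homomorphism, since every vertex of the level is dominated from strictly below.\<close>

lemma cops_win_1_of_ranking:
  fixes f :: "'v \<Rightarrow> real"
  assumes fin: "finite V" and ne: "V \<noteq> {}" and sym: "\<And>u w. E u w \<Longrightarrow> E w u"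
    and clique: "\<And>u w. u \<in> V \<Longrightarrow> w \<in> V \<Longrightarrow> f u \<le> a \<Longrightarrow> f w \<le> a \<Longrightarrow> adj_refl E u w"
    and dom: "\<And>v. v \<in> V \<Longrightarrow> f v > a \<Longrightarrow> \<exists>u\<in>V. f u < f v \<and>
                 (\<forall>w\<in>V. f w \<le> f v \<longrightarrow> adj_refl E v w \<longrightarrow> adj_refl E u w)"
  shows "cops_win V E 1"
proof -
  obtain b where b: "b \<in> V" "\<And>v. v \<in> V \<Longrightarrow> f b \<le> f v"
    using ex_is_arg_min_if_finite[OF fin ne, of f] by (auto simp: is_arg_min_linorder)
  \<comment> \<open>The \<open>Suc\<close> reserves level 0 for \<open>b\<close>, even if other
    vertices tie with it under \<open>f\<close>.\<close>
  define g where "g = (\<lambda>v. if v = b then 0 else Suc (card {w\<in>V. f w < f v}))"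
  have g_less: "g u < g v" if "f u < f v" "v \<noteq> b" "u \<in> V" for u v
  proof -
    have "card {w\<in>V. f w < f u} < card {w\<in>V. f w < f v}"
      using that fin by (intro psubset_card_mono) auto
    then show ?thesis using that by (auto simp: g_def)
  qed
  have g_le: "f w \<le> f v" if "g w \<le> g v" "v \<in> V" "w \<in> V" for w v
    using g_less[of v w] b that by (metis not_le)
  have ex: "\<exists>u\<in>V. g u < g v \<and> (\<forall>w\<in>V. g w \<le> g v \<longrightarrow> adj_refl E v w \<longrightarrow> adj_refl E u w)"
    if v: "v \<in> V" "v \<noteq> b" for v
  proof (cases "f v > a")
    case True
    then obtain u where "u \<in> V" "f u < f v"
      "\<forall>w\<in>V. f w \<le> f v \<longrightarrow> adj_refl E v w \<longrightarrow> adj_refl E u w"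
      using dom[OF v(1)] by auto
    then show ?thesis using g_less v g_le by blast
  next
    case False
    have "g b < g v" using v by (simp add: g_def)
    \<comment> \<open>Here \<open>v\<close> and everything up to its level lie in the clique, so
      \<open>b\<close> itself dominates \<open>v\<close>.\<close>
    moreover have "adj_refl E b w" if "w \<in> V" "g w \<le> g v" for w
    proof (rule clique)
      show "f b \<le> a" using b(2)[of v] v False by simp
      show "f w \<le> a" using g_le[OF that(2) v(1) that(1)] False by simp
    qed (use b that in auto)
    ultimately show ?thesis using b by blast
  qed
  then obtain p where p: "\<And>v. v \<in> V \<Longrightarrow> v \<noteq> b \<Longrightarrow> p v \<in> V \<and> g (p v) < g v \<and>
      (\<forall>w\<in>V. g w \<le> g v \<longrightarrow> adj_refl E v w \<longrightarrow> adj_refl E (p v) w)"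
    by metis
  interpret dismantlable V E g p b
    by unfold_locales (use fin b sym p in \<open>auto simp: g_def\<close>)
  show ?thesis by (rule cops_win_1)
qed

text \<open>Neither side can leave \<open>V\<close>, so a play only sees adjacency within
  \<open>V\<close>. This allows the cop number to be read off from a finite edge set, which later
  gives measurability.\<close>

lemma cops_win_cong_imp:
  assumes E: "\<And>u w. u \<in> V \<Longrightarrow> w \<in> V \<Longrightarrow> E u w = E' u w" and win: "cops_win V E k"
  shows "cops_win V E' k"
proof -
  have legal: "legal_step V E u w = legal_step V E' u w" if "u \<in> V" for u w
    using E that by (auto simp: legal_step_def)
  obtain c0 \<sigma> where c0: "\<forall>i<k. c0 i \<in> V" and w: "\<And>r. robber_walk V E r \<Longrightarrow>
           (\<forall>t. \<forall>i<k. legal_step V E (cop_play c0 \<sigma> r t i) (cop_play c0 \<sigma> r (Suc t) i)) \<and>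
             (\<exists>t. \<exists>i<k. cop_play c0 \<sigma> r t i = r t \<or> cop_play c0 \<sigma> r (Suc t) i = r t)"
    using win unfolding cops_win_def Let_def by blast
  show ?thesis
    unfolding cops_win_def Let_def
  proof (intro exI[of _ c0] exI[of _ \<sigma>] conjI allI impI)
    fix r assume r: "robber_walk V E' r"
    have rV: "r t \<in> V" for t
      using r by (cases t) (auto simp: robber_walk_def legal_step_def)
    then have "robber_walk V E r" using r legal by (auto simp: robber_walk_def)
    note w = w[OF this]
    show "\<exists>t. \<exists>i<k. cop_play c0 \<sigma> r t i = r t \<or> cop_play c0 \<sigma> r (Suc t) i = r t"
      using w by blast
    fix t i assume i: "i < k"
    have "cop_play c0 \<sigma> r t i \<in> V"
    proof (cases t)
      case (Suc s)
      then show ?thesis using w i by (auto simp: legal_step_def simp del: cop_play.simps)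
    qed (use c0 i in auto)
    then show "legal_step V E' (cop_play c0 \<sigma> r t i) (cop_play c0 \<sigma> r (Suc t) i)"
      using w i legal by blast
  qed (use c0 in auto)
qed

lemma cop_number_cong:
  assumes "\<And>u w. u \<in> V \<Longrightarrow> w \<in> V \<Longrightarrow> E u w = E' u w"
  shows "cop_number V E = cop_number V E'"
proof -
  have "cops_win V E k = cops_win V E' k" for k
    using cops_win_cong_imp[of V E E' k] cops_win_cong_imp[of V E' E k] assms by blast
  then show ?thesis by (simp add: cop_number_def)
qed

section \<open>Points dominating a given point\<close>

text \<open>Since \<open>q\<close> is no farther from \<open>c\<close> than \<open>v\<close>,
  \<open>y \<bullet> y \<le> 2 * (y \<bullet> a)\<close> for \<open>y = q - v\<close> and
  \<open>a = c - v\<close>. The linear term of the shift therefore gains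
  \<open>s * (y \<bullet> y)\<close>, while by \<open>small\<close> the errors cost at most
  \<open>s * r\<^sup>2\<close>; what remains is a convex combination of numbers at most
  \<open>r\<^sup>2\<close>.\<close>

lemma dist_le_of_shift:
  fixes v c z q :: "'a::real_inner"
  assumes s: "0 \<le> s" "s \<le> 1" and z: "dist z c \<le> \<rho>" and r: "r \<ge> 0"
    and small: "2 * r * \<rho> + s * (dist v c + \<rho>)\<^sup>2 \<le> r\<^sup>2"
    and q: "dist q v \<le> r" "dist q c \<le> dist v c"
  shows "dist q (v + s *\<^sub>R (z - v)) \<le> r"
proof -
  define y where "y = q - v"
  define a where "a = c - v"
  define u where "u = z - c"
  have "norm (y - a) \<le> norm a" using q(2) by (simp add: y_def a_def dist_norm norm_minus_commute)
  then have "(norm (y - a))\<^sup>2 \<le> (norm a)\<^sup>2" by (simp add: power_mono)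
  then have ya: "y \<bullet> y \<le> 2 * (y \<bullet> a)"
    by (simp add: power2_norm_eq_inner inner_diff_left inner_diff_right inner_commute)
  have y: "norm y \<le> r" and u: "norm u \<le> \<rho>" using q z by (auto simp: y_def u_def dist_norm)
  have yy: "y \<bullet> y \<le> r\<^sup>2" using y by (metis power2_norm_eq_inner power_mono norm_ge_zero)
  have "\<bar>y \<bullet> u\<bar> \<le> r * \<rho>"
    using Cauchy_Schwarz_ineq2[of y u] mult_mono[OF y u] r by (simp add: order_trans)
  then have yu: "- (y \<bullet> u) \<le> r * \<rho>" by linarith
  have "norm (a + u) \<le> dist v c + \<rho>"
    using norm_triangle_ineq[of a u] u by (simp add: a_def dist_norm norm_minus_commute)
  then have au: "(a + u) \<bullet> (a + u) \<le> (dist v c + \<rho>)\<^sup>2"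
    by (metis power2_norm_eq_inner power_mono norm_ge_zero)
  have "(dist q (v + s *\<^sub>R (z - v)))\<^sup>2 = (norm (y - s *\<^sub>R (a + u)))\<^sup>2"
    by (simp add: dist_norm y_def a_def u_def algebra_simps)
  also have "\<dots> = y \<bullet> y - s * (2 * (y \<bullet> a)) + 2 * s * (- (y \<bullet> u)) + s * (s * ((a + u) \<bullet> (a + u)))"
    by (simp add: power2_norm_eq_inner inner_diff_left inner_diff_right inner_add_left inner_add_right
        inner_commute algebra_simps)
  also have "\<dots> \<le> y \<bullet> y - s * (y \<bullet> y) + 2 * s * (r * \<rho>) + s * (s * (dist v c + \<rho>)\<^sup>2)"
    using ya yu au s by (intro add_mono diff_mono mult_left_mono) auto
  also have "\<dots> = (1 - s) * (y \<bullet> y) + s * (2 * r * \<rho> + s * (dist v c + \<rho>)\<^sup>2)"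
    by (simp add: algebra_simps)
  also have "\<dots> \<le> (1 - s) * r\<^sup>2 + s * r\<^sup>2"
    using yy small s by (intro add_mono mult_left_mono) auto
  also have "\<dots> = r\<^sup>2" by (simp add: algebra_simps)
  finally show ?thesis using r by (simp add: power2_le_iff_abs_le)
qed

section \<open>The chain of balls dominating a point\<close>

definition shift_scale :: "real \<Rightarrow> 'a::real_inner \<Rightarrow> 'a \<Rightarrow> real" where
  "shift_scale r c v = r\<^sup>2 / (16 * (dist v c)\<^sup>2)"

text \<open>With R = \<open>dist v c\<close> and t = \<open>shift_scale r c v\<close>, the indices
  with \<open>2 * \<rho> * k\<close> < R give fractions of the segment from \<open>v\<close> to
  \<open>c\<close> between t/2 and t; consecutive centres are t\<rho> apart.\<close>

definition dom_center :: "'a::real_inner \<Rightarrow> real \<Rightarrow> real \<Rightarrow> 'a \<Rightarrow> nat \<Rightarrow> 'a" where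
  "dom_center c r \<rho> v k =
     v + (shift_scale r c v * (1/2 + real k * \<rho> / dist v c)) *\<^sub>R (c - v)"

text \<open>The homothety at \<open>v\<close> with ratio s \<ge> t/2 maps the ball of radius \<rho>
  about \<open>c\<close> to one of radius s\<rho>, which contains the ball of radius t\<rho>/2 taken
  here. A union of balls makes volume and measurability elementary.\<close>

definition dom_region :: "'a::real_inner \<Rightarrow> real \<Rightarrow> real \<Rightarrow> 'a \<Rightarrow> 'a set" where
  "dom_region c r \<rho> v = (\<Union>k\<in>{k. 2 * \<rho> * real k < dist v c}.
     ball (dom_center c r \<rho> v k) (shift_scale r c v * \<rho> / 2))"

lemma dom_regionE:
  fixes c v p :: "'a::real_inner"
  assumes p: "p \<in> dom_region c r \<rho> v" and "r > 0" "\<rho> > 0" and v: "dist v c > r / 2"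
  obtains s z where "p = v + s *\<^sub>R (z - v)" "dist z c \<le> \<rho>" "0 < s" "s \<le> shift_scale r c v"
proof -
  define t where "t = shift_scale r c v"
  define R where "R = dist v c"
  have R: "R > 0" using assms unfolding R_def by linarith
  have t: "t > 0" using assms R by (simp add: t_def shift_scale_def R_def)
  obtain k where k: "2 * \<rho> * real k < R"
    and pk: "dist (v + (t * (1/2 + real k * \<rho> / R)) *\<^sub>R (c - v)) p < t * \<rho> / 2"
    using p by (auto simp: dom_region_def dom_center_def t_def R_def)
  define s where "s = t * (1/2 + real k * \<rho> / R)"
  \<comment> \<open>The preimage of \<open>p\<close> under the homothety whose ratio
    \<open>s\<close> belongs to the centre of the ball containing \<open>p\<close>.\<close>
  define z where "z = v + (1 / s) *\<^sub>R (p - v)"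
  have kR: "real k * \<rho> / R \<le> 1/2" "0 \<le> real k * \<rho> / R"
    using k R \<open>\<rho> > 0\<close> by (auto simp: field_simps)
  have "t * (1/2) \<le> s" unfolding s_def using t kR by (intro mult_left_mono) auto
  have "1/2 + real k * \<rho> / R \<le> 1" using kR by linarith
  then have s_le: "s \<le> t" unfolding s_def using t by (simp add: mult_left_le)
  have s: "s > 0" using t \<open>t * (1/2) \<le> s\<close> by linarith
  have "z - c = (1 / s) *\<^sub>R (p - (v + s *\<^sub>R (c - v)))"
    using s by (simp add: z_def algebra_simps)
  then have "dist z c = dist (v + s *\<^sub>R (c - v)) p / s"
    using s by (simp add: dist_norm norm_minus_commute)
  also have "\<dots> \<le> (t * \<rho> / 2) / s" using pk s by (intro divide_right_mono) (auto simp: s_def)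
  also have "\<dots> \<le> \<rho>" using mult_right_mono[OF \<open>t * (1/2) \<le> s\<close>, of \<rho>] s \<open>\<rho> > 0\<close>
    by (simp add: field_simps)
  finally have "dist z c \<le> \<rho>" .
  moreover have "p = v + s *\<^sub>R (z - v)" using s by (simp add: z_def)
  ultimately show ?thesis using that s s_le by (simp add: t_def)
qed

lemma shift_scale_le:
  assumes "dist v c > r / 2" "r > 0"
  shows "shift_scale r c v \<le> 1 / 4"
proof -
  have "(r/2)\<^sup>2 \<le> (dist v c)\<^sup>2" using assms by (intro power_mono) auto
  moreover have "(dist v c)\<^sup>2 > 0" using assms by auto
  ultimately show ?thesis by (simp add: shift_scale_def field_simps power2_eq_square)
qed

text \<open>First claim: \<open>p\<close> is a proper convex combination of \<open>v\<close> and a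
  point \<open>z\<close> strictly closer to \<open>c\<close>. Second claim:
  \<open>dist_le_of_shift\<close>, where the quadratic term costs at most
  \<open>r\<^sup>2 / 4\<close> and \<open>2 * r * \<rho>\<close> at most
  \<open>r\<^sup>2 / 2\<close>.\<close>

lemma dom_region_dominates:
  fixes c v p q :: "'a::real_inner"
  assumes p: "p \<in> dom_region c r \<rho> v" and r: "r > 0" and \<rho>: "0 < \<rho>" "\<rho> \<le> r / 4"
    and v: "dist v c > r / 2"
  shows "dist p c < dist v c"
    and "dist q v \<le> r \<Longrightarrow> dist q c \<le> dist v c \<Longrightarrow> dist q p \<le> r"
proof -
  obtain s z where sz: "p = v + s *\<^sub>R (z - v)" "dist z c \<le> \<rho>" "0 < s" "s \<le> shift_scale r c v"
    using dom_regionE[OF p r \<rho>(1) v] by blast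
  have s1: "s \<le> 1" using sz(4) shift_scale_le[OF v r] by simp
  have "p - c = (1 - s) *\<^sub>R (v - c) + s *\<^sub>R (z - c)" using sz(1) by (simp add: algebra_simps)
  then have "norm (p - c) \<le> norm ((1 - s) *\<^sub>R (v - c)) + norm (s *\<^sub>R (z - c))"
    by (metis norm_triangle_ineq)
  then have "dist p c \<le> (1 - s) * dist v c + s * dist z c"
    using s1 sz(3) by (simp add: dist_norm)
  also have "\<dots> < (1 - s) * dist v c + s * dist v c"
    using sz(2,3) \<rho> v r by (intro add_strict_left_mono mult_strict_left_mono) auto
  also have "\<dots> = dist v c" by (simp add: algebra_simps)
  finally show "dist p c < dist v c" .
  \<comment> \<open>As \<rho> < \<open>dist v c\<close>, the sum is at most twice
    \<open>dist v c\<close>; the 16 in \<open>shift_scale\<close> is chosen to turn this into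
    \<open>r\<^sup>2 / 4\<close>.\<close>
  have "s * (dist v c + \<rho>)\<^sup>2 \<le> shift_scale r c v * (2 * dist v c)\<^sup>2"
    using sz(3,4) \<rho> v r by (intro mult_mono power_mono) auto
  also have "\<dots> = r\<^sup>2 / 4" using v r by (auto simp: shift_scale_def power2_eq_square)
  finally have "s * (dist v c + \<rho>)\<^sup>2 \<le> r\<^sup>2 / 4" .
  moreover have "2 * r * \<rho> \<le> r\<^sup>2 / 2"
    using mult_left_mono[OF \<rho>(2), of "2 * r"] r by (simp add: power2_eq_square)
  ultimately have "2 * r * \<rho> + s * (dist v c + \<rho>)\<^sup>2 \<le> r\<^sup>2" using zero_le_power2[of r] by linarith
  then show "dist q p \<le> r" if "dist q v \<le> r" "dist q c \<le> dist v c"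
    unfolding sz(1) using that sz r s1 by (intro dist_le_of_shift[where c = c and \<rho> = \<rho>]) auto
qed

text \<open>Each point lies on a segment from \<open>v\<close> to the ball about \<open>c\<close>.
  With the cube as \<open>S\<close>, no volume is lost even for \<open>v\<close> on the
  boundary.\<close>

lemma dom_region_subset:
  fixes c v :: "'a::real_inner"
  assumes "convex S" "v \<in> S" "cball c \<rho> \<subseteq> S" "r > 0" "\<rho> > 0" "dist v c > r / 2"
  shows "dom_region c r \<rho> v \<subseteq> S"
proof
  fix p assume "p \<in> dom_region c r \<rho> v"
  then obtain s z where sz: "p = v + s *\<^sub>R (z - v)" "dist z c \<le> \<rho>" "0 < s" "s \<le> shift_scale r c v"
    using dom_regionE assms by blast
  have "s \<le> 1" using sz(4) shift_scale_le[of r v c] assms by simp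
  moreover have "z \<in> S" using sz assms by (auto simp: dist_commute)
  ultimately have "(1 - s) *\<^sub>R v + s *\<^sub>R z \<in> S" using assms sz by (simp add: convexD)
  moreover have "(1 - s) *\<^sub>R v + s *\<^sub>R z = p" using sz by (simp add: algebra_simps)
  ultimately show "p \<in> S" by simp
qed

text \<open>The defining balls of the region are pairwise disjoint.\<close>

lemma measure_dom_region:
  fixes c v :: "'a::euclidean_space"
  assumes r: "r > 0" and \<rho>: "\<rho> > 0" and v: "dist v c > r / 2"
  shows "measure lborel (dom_region c r \<rho> v) \<ge> dist v c / (2 * \<rho>) *
           (unit_ball_vol (real DIM('a)) * (shift_scale r c v * \<rho> / 2) ^ DIM('a))"
proof -
  define t where "t = shift_scale r c v"
  define R where "R = dist v c"
  have R: "R > 0" using assms unfolding R_def by linarith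
  have t: "t > 0" using assms R by (simp add: t_def shift_scale_def R_def)
  \<comment> \<open>The index 0 counts, so the number of balls is the rounded-up quotient.\<close>
  define N where "N = nat \<lceil>R / (2 * \<rho>)\<rceil>"
  have K: "{k. 2 * \<rho> * real k < dist v c} = {..<N}"
  proof (intro set_eqI)
    fix k :: nat
    have "2 * \<rho> * real k < R \<longleftrightarrow> real k < R / (2 * \<rho>)" using \<rho> by (simp add: field_simps)
    also have "\<dots> \<longleftrightarrow> k < N" unfolding N_def by linarith
    finally show "k \<in> {k. 2 * \<rho> * real k < dist v c} \<longleftrightarrow> k \<in> {..<N}" by (simp add: R_def)
  qed
  define B where "B k = ball (dom_center c r \<rho> v k) (t * \<rho> / 2)" for k
  have D: "dom_region c r \<rho> v = (\<Union>k<N. B k)" by (simp add: dom_region_def K B_def t_def)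
  have "B k \<inter> B l = {}" if "k \<noteq> l" for k l
  proof -
    have "dom_center c r \<rho> v k - dom_center c r \<rho> v l
        = (t * (1/2 + real k * \<rho> / R) - t * (1/2 + real l * \<rho> / R)) *\<^sub>R (c - v)"
      by (simp add: dom_center_def t_def R_def scaleR_left_diff_distrib)
    also have "t * (1/2 + real k * \<rho> / R) - t * (1/2 + real l * \<rho> / R)
        = t * \<rho> / R * (real k - real l)"
      using R by (simp add: field_simps)
    finally have "dom_center c r \<rho> v k - dom_center c r \<rho> v l
        = (t * \<rho> / R * (real k - real l)) *\<^sub>R (c - v)" .
    then have "dist (dom_center c r \<rho> v k) (dom_center c r \<rho> v l) = t * \<rho> * \<bar>real k - real l\<bar>"
      using t \<rho> R by (simp add: dist_norm abs_mult R_def norm_minus_commute)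
    moreover have "\<bar>real k - real l\<bar> \<ge> 1" using that by linarith
    ultimately have "dist (dom_center c r \<rho> v k) (dom_center c r \<rho> v l) \<ge> t * \<rho>"
      using t \<rho> mult_left_mono[of 1 "\<bar>real k - real l\<bar>" "t * \<rho>"] by simp
    then show ?thesis unfolding B_def by (intro disjoint_ballI) (simp add: mult.commute)
  qed
  then have disj: "disjoint_family_on B {..<N}" by (auto simp: disjoint_family_on_def)
  then have "measure lborel (dom_region c r \<rho> v) = (\<Sum>k<N. measure lborel (B k))"
    unfolding D
  proof (intro measure_finite_Union)
    show "emeasure lborel (B k) \<noteq> \<infinity>" for k
      using emeasure_lborel_ball_finite[of "dom_center c r \<rho> v k" "t * \<rho> / 2"] by (simp add: B_def)
  qed (use disj in \<open>auto simp: B_def[abs_def]\<close>)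
  also have "\<dots> = real N * (unit_ball_vol (real DIM('a)) * (t * \<rho> / 2) ^ DIM('a))"
    using t \<rho> by (simp add: B_def content_ball)
  finally have "measure lborel (dom_region c r \<rho> v)
      = real N * (unit_ball_vol (real DIM('a)) * (t * \<rho> / 2) ^ DIM('a))" .
  moreover have "real N \<ge> R / (2 * \<rho>)" unfolding N_def by linarith
  moreover have "unit_ball_vol (real DIM('a)) * (t * \<rho> / 2) ^ DIM('a) \<ge> 0" using t \<rho> by simp
  ultimately show ?thesis unfolding t_def R_def by (metis mult_right_mono)
qed

text \<open>With \<rho> = r/(4d) and R = \<open>dist v c\<close> there are at least 2dR/r balls of
  radius r^3/(128 d R^2), where 128 = 16 * 4 * 2. Their volume is thus at least a constant times
  r^(3d-1) R^(1-2d), and R \<le> d removes the dependence on \<open>v\<close>.\<close>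

lemma measure_dom_region_ge:
  fixes c v :: "'a::euclidean_space"
  defines "d \<equiv> DIM('a)"
  assumes r: "r > 0" and v: "dist v c > r / 2" "dist v c \<le> real d"
  shows "measure lborel (dom_region c r (r / (4 * real d)) v) \<ge>
    2 * real d * unit_ball_vol (real d) / ((128 * real d) ^ d * real d ^ (2 * d - 1)) * r ^ (3 * d - 1)"
proof -
  define R where "R = dist v c"
  have R: "R > 0" "R \<le> d" using r v unfolding R_def by auto
  have d: "d > 0" by (simp add: d_def)
  have [simp]: "r ^ (3 * d) = r * r ^ (3 * d - 1)" "R ^ (2 * d) = R * R ^ (2 * d - 1)"
    using d by (simp_all add: power_Suc[symmetric] del: power_Suc)
  have "2 * real d * unit_ball_vol (real d) / ((128 * real d) ^ d * real d ^ (2 * d - 1)) * r ^ (3 * d - 1)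
      \<le> 2 * real d * unit_ball_vol (real d) / ((128 * real d) ^ d * R ^ (2 * d - 1)) * r ^ (3 * d - 1)"
    using R d r by (intro mult_right_mono divide_left_mono mult_left_mono mult_pos_pos zero_less_power power_mono) (auto intro: power_mono)
  also have "\<dots> = R / (2 * (r / (4 * real d))) * (unit_ball_vol (real d) * ((r\<^sup>2 / (16 * R\<^sup>2)) * (r / (4 * real d)) / 2) ^ d)"
  proof -
    have "(r\<^sup>2 / (16 * R\<^sup>2)) * (r / (4 * real d)) / 2 = r ^ 3 / (128 * real d * R\<^sup>2)"
      by (simp add: power2_eq_square power3_eq_cube)
    also have "\<dots> ^ d = r * r ^ (3 * d - 1) / ((128 * real d) ^ d * (R * R ^ (2 * d - 1)))"
      by (simp add: power_divide power_mult_distrib power_mult[symmetric])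
    finally show ?thesis using R r d by (simp add: field_simps)
  qed
  also have "\<dots> \<le> measure lborel (dom_region c r (r / (4 * real d)) v)"
    using measure_dom_region[OF r _ v(1), of "r / (4 * real d)"] r d
    by (simp add: R_def shift_scale_def d_def)
  finally show ?thesis .
qed

text \<open>Membership is a countable disjunction over \<open>k\<close> of strict inequalities,
  hence jointly measurable in both points.\<close>

lemma pred_dom_region [measurable (raw)]:
  fixes c :: "'a::euclidean_space"
  assumes [measurable]: "f \<in> borel_measurable M" "h \<in> borel_measurable M"
  shows "Measurable.pred M (\<lambda>x. h x \<in> dom_region c r \<rho> (f x))"
  unfolding dom_region_def dom_center_def shift_scale_def by simp measurable

section \<open>Random points\<close>

text \<open>Fix the point of \<open>i\<close> by Fubini: the other points are independent, and each
  misses with probability at most 1 - q \<le> exp(-q).\<close>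

lemma measure_PiM_no_partner:
  fixes U :: "'a measure" and q :: real
  assumes U: "prob_space U" and fin: "finite I" and i: "i \<in> I"
    and H[measurable]: "Measurable.pred U H"
    and Q[measurable]: "Measurable.pred (U \<Otimes>\<^sub>M U) (\<lambda>(v, p). Q v p)"
    and q: "\<And>v. v \<in> space U \<Longrightarrow> H v \<Longrightarrow> measure U {p \<in> space U. Q v p} \<ge> q"
  shows "measure (PiM I (\<lambda>_. U))
           {x \<in> space (PiM I (\<lambda>_. U)). H (x i) \<and> (\<forall>j\<in>I - {i}. \<not> Q (x i) (x j))}
         \<le> exp (- q) ^ (card I - 1)"
proof -
  interpret U: prob_space U by fact
  interpret P: product_prob_space "\<lambda>_::'b. U" ..
  define J where "J = I - {i}"
  have I: "I = insert i J" and iJ: "i \<notin> J" and J: "finite J" using i fin by (auto simp: J_def)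
  define A where "A = {x \<in> space (PiM I (\<lambda>_. U)). H (x i) \<and> (\<forall>j\<in>J. \<not> Q (x i) (x j))}"
  have A[measurable]: "A \<in> sets (PiM (insert i J) (\<lambda>_. U))"
    unfolding A_def I using J by measurable
  have "emeasure (PiM I (\<lambda>_. U)) A = (\<integral>\<^sup>+ x. indicator A x \<partial>PiM (insert i J) (\<lambda>_. U))"
    using A I by simp
  also have "\<dots> = (\<integral>\<^sup>+ y. (\<integral>\<^sup>+ x. indicator A (x(i := y)) \<partial>PiM J (\<lambda>_. U)) \<partial>U)"
    using J iJ by (intro P.product_nn_integral_insert_rev) auto
  also have "\<dots> \<le> (\<integral>\<^sup>+ y. ennreal (exp (- q) ^ card J) \<partial>U)"
  proof (rule nn_integral_mono)
    fix y assume y: "y \<in> space U"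
    show "(\<integral>\<^sup>+ x. indicator A (x(i := y)) \<partial>PiM J (\<lambda>_. U)) \<le> ennreal (exp (- q) ^ card J)"
    proof (cases "H y")
      case True
      define B where "B = {p \<in> space U. \<not> Q y p}"
      have B[measurable]: "B \<in> sets U" unfolding B_def using y by measurable
      have "measure U B = 1 - measure U {p \<in> space U. Q y p}"
        using U.prob_neg[of "Q y"] y by (simp add: B_def)
      also have "\<dots> \<le> 1 - q" using q[OF y True] by simp
      also have "\<dots> \<le> exp (- q)" using exp_ge_add_one_self[of "- q"] by simp
      finally have "emeasure U B \<le> ennreal (exp (- q))"
        by (simp add: U.emeasure_eq_measure)
      then have "emeasure U B ^ card J \<le> ennreal (exp (- q)) ^ card J"
        by (intro power_mono) auto
      \<comment> \<open>The slice of \<open>A\<close> at \<open>y\<close> is the product of copies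
        of \<open>B\<close> over \<open>J\<close>.\<close>
      moreover have "(\<integral>\<^sup>+ x. indicator A (x(i := y)) \<partial>PiM J (\<lambda>_. U))
          = (\<integral>\<^sup>+ x. indicator (PiE J (\<lambda>_. B)) x \<partial>PiM J (\<lambda>_. U))"
        using y True iJ
        by (intro nn_integral_cong)
           (auto simp: A_def B_def I indicator_def space_PiM PiE_iff extensional_def)
      moreover have "\<dots> = emeasure U B ^ card J"
        using J B by (subst nn_integral_indicator) (auto simp: P.emeasure_PiM intro!: sets_PiM_I_finite)
      ultimately show ?thesis by (simp add: ennreal_power)
    next
      case False
      then have "indicator A (x(i := y)) = (0::ennreal)" for x by (simp add: A_def)
      then show ?thesis by simp
    qed
  qed
  also have "\<dots> = ennreal (exp (- q) ^ card J)" by (simp add: U.emeasure_space_1)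
  finally have "emeasure (PiM I (\<lambda>_. U)) A \<le> ennreal (exp (- q) ^ card J)" .
  then have "measure (PiM I (\<lambda>_. U)) A \<le> exp (- q) ^ card J"
    by (simp add: measure_def enn2real_leI)
  then show ?thesis using i fin by (simp add: A_def J_def)
qed

text \<open>There are finitely many graphs on \<open>{..<n}\<close>, and each arises on an event cut
  out by finitely many distance conditions; the event is a finite union of these.\<close>

lemma sets_cop_number:
  fixes M :: "'a::euclidean_space measure"
  assumes [measurable_cong]: "sets M = sets borel"
  shows "{x \<in> space (PiM {..<n} (\<lambda>_. M)). cop_number {..<n} (rgg_adj x r) = k}
           \<in> sets (PiM {..<n} (\<lambda>_. M))"
proof -
  let ?P = "PiM {..<n} (\<lambda>_. M)" and ?V = "{..<n}"
  let ?S = "\<lambda>G. {x \<in> space ?P. \<forall>u\<in>?V. \<forall>w\<in>?V. rgg_adj x r u w \<longleftrightarrow> (u, w) \<in> G}"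
  have "{x \<in> space ?P. cop_number ?V (rgg_adj x r) = k}
      = (\<Union>G\<in>{G \<in> Pow (?V \<times> ?V). cop_number ?V (\<lambda>u w. (u, w) \<in> G) = k}. ?S G)" (is "?L = ?R")
  proof (intro equalityI subsetI)
    fix x assume x: "x \<in> ?L"
    let ?G = "{(u, w) \<in> ?V \<times> ?V. rgg_adj x r u w}"
    have "cop_number ?V (rgg_adj x r) = cop_number ?V (\<lambda>u w. (u, w) \<in> ?G)"
      by (rule cop_number_cong) auto
    then show "x \<in> ?R" using x by (intro UN_I[of ?G]) auto
  next
    fix x assume "x \<in> ?R"
    then obtain G where "cop_number ?V (\<lambda>u w. (u, w) \<in> G) = k" "x \<in> ?S G" by auto
    moreover from this have "cop_number ?V (rgg_adj x r) = cop_number ?V (\<lambda>u w. (u, w) \<in> G)"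
      by (intro cop_number_cong) auto
    ultimately show "x \<in> ?L" by auto
  qed
  also have "\<dots> \<in> sets ?P"
    unfolding rgg_adj_def by (intro sets.finite_UN) measurable
  finally show ?thesis .
qed

text \<open>The deterministic part: rank by distance from \<open>c\<close>. Points within r/2 of
  \<open>c\<close> form a clique by the triangle inequality; every other vertex folds onto one in
  its region.\<close>

lemma cop_number_rgg_eq_1:
  fixes x :: "nat \<Rightarrow> 'a::real_inner"
  assumes n: "n > 0" and r: "r > 0" and \<rho>: "0 < \<rho>" "\<rho> \<le> r / 4"
    and dom: "\<And>i. i < n \<Longrightarrow> dist (x i) c > r / 2 \<Longrightarrow> \<exists>j<n. x j \<in> dom_region c r \<rho> (x i)"
  shows "cop_number {..<n} (rgg_adj x r) = 1"
proof (rule cop_number_eq_1, rule cops_win_1_of_ranking[where f = "\<lambda>i. dist (x i) c" and a = "r / 2"])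
  show "{..<n} \<noteq> {}" using n by auto
  show "rgg_adj x r w u" if "rgg_adj x r u w" for u w
    using that by (auto simp: rgg_adj_def dist_commute)
  show "adj_refl (rgg_adj x r) u w" if "dist (x u) c \<le> r / 2" "dist (x w) c \<le> r / 2" for u w
    using dist_triangle2[of "x u" "x w" c] that by (auto simp: adj_refl_def rgg_adj_def)
next
  fix v assume v: "v \<in> {..<n}" "dist (x v) c > r / 2"
  then obtain j where j: "j < n" "x j \<in> dom_region c r \<rho> (x v)" using dom by auto
  note D = dom_region_dominates[OF j(2) r \<rho> v(2)]
  have "adj_refl (rgg_adj x r) j w"
    if "dist (x w) c \<le> dist (x v) c" "adj_refl (rgg_adj x r) v w" for w
    using D(2)[of "x w"] that r by (auto simp: adj_refl_def rgg_adj_def dist_commute)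
  then show "\<exists>u\<in>{..<n}. dist (x u) c < dist (x v) c \<and> (\<forall>w\<in>{..<n}. dist (x w) c \<le> dist (x v) c \<longrightarrow>
      adj_refl (rgg_adj x r) v w \<longrightarrow> adj_refl (rgg_adj x r) u w)"
    using j D(1) by blast
qed simp

text \<open>Union bound over the vertices far from the centre whose region contains no other
  point.\<close>

lemma prob_cop_number_rgg_ge:
  fixes r :: real
  defines "d \<equiv> CARD('d::finite)"
  defines "\<kappa> \<equiv> 2 * real d * unit_ball_vol (real d) / ((128 * real d) ^ d * real d ^ (2 * d - 1))"
  assumes n: "n > 0" and r: "r > 0"
  shows "measure (rgg_space n :: (nat \<Rightarrow> real ^ 'd) measure)
           {x \<in> space (rgg_space n). cop_number {..<n} (rgg_adj x r) = 1}
         \<ge> 1 - n * exp (- (\<kappa> * r ^ (3 * d - 1))) ^ (n - 1)"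
proof -
  define C where "C = cbox (0 :: real ^ 'd) One"
  define U where "U = uniform_measure lborel C"
  define P where "P = PiM {..<n} (\<lambda>_. U)"
  define c :: "real ^ 'd" where "c = (1/2) *\<^sub>R One"
  \<comment> \<open>At most r/4, as domination requires, and at most 1/2 as soon as some point of
    the cube is farther than r/2 from \<open>c\<close>, because then r < 2d; so the ball about
    \<open>c\<close> fits in the cube.\<close>
  define \<rho> where "\<rho> = r / (4 * real d)"
  define q where "q = \<kappa> * r ^ (3 * d - 1)"
  have dD: "d = DIM(real ^ 'd)" by (simp add: d_def)
  have d: "d > 0" by (simp add: d_def)
  have \<rho>: "0 < \<rho>" "\<rho> \<le> r / 4" using r d by (auto simp: \<rho>_def field_simps)
  have C1: "emeasure lborel C = 1" "measure lborel C = 1"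
    by (simp_all add: C_def emeasure_lborel_cbox_eq)
  interpret U: prob_space U
    unfolding U_def by (rule prob_space_uniform_measure) (simp_all add: C1)
  interpret P: prob_space P
    unfolding P_def by (intro prob_space_PiM U.prob_space_axioms)
  have [measurable_cong]: "sets U = sets borel" by (simp add: U_def)
  have spU: "space U = UNIV" by (simp add: U_def)
  have c_cmp: "c \<bullet> b = 1/2" if "b \<in> Basis" for b using that by (simp add: c_def)
  have mem_C: "v \<in> C \<longleftrightarrow> (\<forall>b\<in>Basis. 0 \<le> v \<bullet> b \<and> v \<bullet> b \<le> 1)" for v
    by (simp add: C_def mem_box)
  have dist_C: "dist v c \<le> d" if "v \<in> C" for v
  proof -
    have "dist v c \<le> (\<Sum>b\<in>Basis. \<bar>(v - c) \<bullet> b\<bar>)" unfolding dist_norm by (rule norm_le_l1)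
    also have "\<dots> \<le> (\<Sum>b\<in>(Basis :: (real ^ 'd) set). 1)"
      using that by (intro sum_mono) (auto simp: mem_C inner_diff_left c_cmp abs_le_iff)
    also have "\<dots> = d" by (simp add: dD)
    finally show ?thesis .
  qed
  \<comment> \<open>The space of \<open>U\<close> is all of \<open>real ^ 'd\<close>, so membership
    in the cube is part of \<open>H\<close>; \<open>AE_C\<close> supplies it for the random
    points.\<close>
  define H where "H v \<longleftrightarrow> v \<in> C \<and> dist v c > r / 2" for v
  have C_sets[measurable]: "C \<in> sets borel" by (simp add: C_def)
  have H_meas[measurable]: "Measurable.pred borel H" unfolding H_def by measurable
  have q: "measure U {p \<in> space U. p \<in> dom_region c r \<rho> v} \<ge> q" if "H v" for v
  proof -
    have v: "v \<in> C" "dist v c > r / 2" using that by (auto simp: H_def)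
    then have "r / 2 < d" using dist_C[of v] by linarith
    then have "\<rho> \<le> 1/2" using d by (simp add: \<rho>_def field_simps)
    have "cball c \<rho> \<subseteq> C"
    proof
      fix z assume "z \<in> cball c \<rho>"
      then have "norm (z - c) \<le> 1/2" using \<open>\<rho> \<le> 1/2\<close> by (simp add: dist_norm norm_minus_commute)
      then have zb: "\<bar>(z - c) \<bullet> b\<bar> \<le> 1/2" if "b \<in> Basis" for b
        using Basis_le_norm[OF that, of "z - c"] by linarith
      have "0 \<le> z \<bullet> b \<and> z \<bullet> b \<le> 1" if "b \<in> Basis" for b
        using zb[OF that] c_cmp[OF that] unfolding inner_diff_left by linarith
      then show "z \<in> C" by (simp add: mem_C)
    qed
    then have sub: "dom_region c r \<rho> v \<subseteq> C"
      using v r \<rho> by (intro dom_region_subset) (auto simp: C_def)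
    have [measurable]: "dom_region c r \<rho> v \<in> sets borel"
      unfolding dom_region_def by (intro sets.countable_UN') auto
    have "measure U {p \<in> space U. p \<in> dom_region c r \<rho> v}
        = measure lborel (C \<inter> dom_region c r \<rho> v) / measure lborel C"
      unfolding U_def by (subst measure_uniform_measure) (auto simp: C1)
    also have "\<dots> = measure lborel (dom_region c r \<rho> v)"
      using sub by (simp add: C1 Int_absorb1)
    also have "\<dots> \<ge> q"
      using measure_dom_region_ge[OF r v(2)] dist_C[OF v(1)]
      by (simp add: q_def \<kappa>_def \<rho>_def dD)
    finally show ?thesis .
  qed
  define Bad where
    "Bad i = {x \<in> space P. H (x i) \<and> (\<forall>j\<in>{..<n} - {i}. \<not> x j \<in> dom_region c r \<rho> (x i))}" for i
  define Good where "Good = {x \<in> space P. cop_number {..<n} (rgg_adj x r) = 1}"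
  have Bad_le: "measure P (Bad i) \<le> exp (- q) ^ (n - 1)" if "i < n" for i
    using measure_PiM_no_partner[OF U.prob_space_axioms, of "{..<n}" i H
        "\<lambda>v p. p \<in> dom_region c r \<rho> v" q] that q
    by (simp add: Bad_def P_def)
  have comp: "(\<lambda>x. x j) \<in> borel_measurable P" if "j < n" for j
  proof -
    have "(\<lambda>x. x j) \<in> P \<rightarrow>\<^sub>M U" unfolding P_def using that by (intro measurable_component_singleton) simp
    then show ?thesis by (simp add: U_def cong: measurable_cong_sets)
  qed
  have Bad_sets: "Bad i \<in> sets P" if i: "i < n" for i
  proof -
    have [measurable]: "(\<lambda>x. x i) \<in> borel_measurable P" by (rule comp[OF i])
    have "Measurable.pred P (\<lambda>x. x j \<notin> dom_region c r \<rho> (x i))" if "j < n" for j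
      using pred_dom_region[OF comp[OF i] comp[OF that]] by measurable
    then have [measurable]:
      "Measurable.pred P (\<lambda>x. \<forall>j\<in>{..<n} - {i}. x j \<notin> dom_region c r \<rho> (x i))"
      by (intro pred_intros_finite) auto
    show ?thesis unfolding Bad_def by measurable
  qed
  have Good_sets: "Good \<in> sets P"
    unfolding Good_def P_def by (rule sets_cop_number) (simp add: U_def)
  have "AE p in U. p \<in> C" unfolding U_def by (rule AE_uniform_measureI) auto
  then have "AE x in P. x i \<in> C" if "i < n" for i
    unfolding P_def using that U.prob_space_axioms by (intro AE_PiM_component) auto
  then have AE_C: "AE x in P. \<forall>i\<in>{..<n}. x i \<in> C" by (intro AE_finite_allI) auto
  have "measure P (space P - Good) \<le> measure P (\<Union>i<n. Bad i)"
  \<comment> \<open>The inclusion is shown only where all points lie in the cube, hence almost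
    everywhere.\<close>
  proof (rule P.finite_measure_mono_AE)
    show "AE x in P. x \<in> space P - Good \<longrightarrow> x \<in> (\<Union>i<n. Bad i)"
      using AE_C
    proof eventually_elim
      case (elim x)
      show ?case
      proof (rule impI, rule ccontr)
        assume x: "x \<in> space P - Good" and nb: "x \<notin> (\<Union>i<n. Bad i)"
        have "cop_number {..<n} (rgg_adj x r) = 1"
        proof (rule cop_number_rgg_eq_1[OF n r \<rho>])
          fix i assume "i < n" "r / 2 < dist (x i) c"
          then show "\<exists>j<n. x j \<in> dom_region c r \<rho> (x i)"
            using nb x elim by (auto simp: Bad_def H_def)
        qed
        then show False using x by (simp add: Good_def)
      qed
    qed
  qed (use Bad_sets in auto)
  also have "\<dots> \<le> (\<Sum>i<n. measure P (Bad i))"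
    using Bad_sets by (intro measure_UNION_le) auto
  also have "\<dots> \<le> (\<Sum>i<n. exp (- q) ^ (n - 1))" using Bad_le by (intro sum_mono) auto
  finally have "measure P Good \<ge> 1 - n * exp (- q) ^ (n - 1)"
    using P.prob_compl[OF Good_sets] by simp
  then show ?thesis by (simp add: Good_def P_def U_def C_def q_def rgg_space_def)
qed

section \<open>Choice of the constant and passage to the limit\<close>

theorem theorem2p2:
  assumes "CARD('d::finite) \<ge> 2"
  shows "\<exists>c>0. \<forall>r :: nat \<Rightarrow> real.
           (\<forall>n. r n > 0 \<and> r n ^ (3 * CARD('d) - 1) > c * ln (real n) / real n) \<longrightarrow>
           ((\<lambda>n. measure (rgg_space n :: (nat \<Rightarrow> real ^ 'd) measure)
                   {x \<in> space (rgg_space n). cop_number {..<n} (rgg_adj x (r n)) = 1})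
             \<longlonglongrightarrow> 1)"
proof -
  define d where "d = CARD('d)"
  define \<kappa> where "\<kappa> = 2 * real d * unit_ball_vol (real d) / ((128 * real d) ^ d * real d ^ (2 * d - 1))"
  have d: "d > 0" by (simp add: d_def)
  then have \<kappa>: "\<kappa> > 0" by (simp add: \<kappa>_def)
  show ?thesis
  \<comment> \<open>This constant gives q \<ge> 4 ln n / n. As n - 1 \<ge> n/2 for n \<ge> 2, each
    vertex fails with probability at most exp(-2 ln n) = 1/n^2, and the union bound leaves
    1/n.\<close>
  proof (rule exI[of _ "4 / \<kappa>"], intro conjI allI impI)
    show "4 / \<kappa> > 0" using \<kappa> by simp
    fix r :: "nat \<Rightarrow> real"
    assume "\<forall>n. r n > 0 \<and> r n ^ (3 * CARD('d) - 1) > 4 / \<kappa> * ln (real n) / real n"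
    then have r: "r n > 0" "r n ^ (3 * d - 1) > 4 / \<kappa> * ln (real n) / real n" for n
      by (auto simp: d_def)
    let ?p = "\<lambda>n. measure (rgg_space n :: (nat \<Rightarrow> real ^ 'd) measure)
                   {x \<in> space (rgg_space n). cop_number {..<n} (rgg_adj x (r n)) = 1}"
    have lower: "?p n \<ge> 1 - 1 / real n" if n: "n \<ge> 2" for n
    proof -
      define q where "q = \<kappa> * r n ^ (3 * d - 1)"
      have "q \<ge> \<kappa> * (4 / \<kappa> * ln (real n) / real n)"
        unfolding q_def using r(2)[of n] \<kappa> by (intro mult_left_mono) auto
      then have q: "q \<ge> 4 * ln (real n) / real n" using \<kappa> by simp
      have "2 * ln (real n) \<le> (4 * ln (real n) / real n) * (real n - 1)"
      proof -
        have "ln (real n) * (2 * real n) \<le> ln (real n) * (4 * (real n - 1))"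
          using n by (intro mult_left_mono) auto
        then show ?thesis using n by (simp add: field_simps)
      qed
      also have "\<dots> \<le> q * (real n - 1)" using q n by (intro mult_right_mono) auto
      finally have "- (q * (real n - 1)) \<le> - (2 * ln (real n))" by simp
      then have "exp (- (q * (real n - 1))) \<le> exp (- (2 * ln (real n)))" by simp
      also have "\<dots> = 1 / (real n)\<^sup>2"
        using n by (simp add: exp_minus exp_double field_simps)
      finally have "exp (- q) ^ (n - 1) \<le> 1 / (real n)\<^sup>2"
        using n by (simp add: exp_of_nat_mult[symmetric] of_nat_diff mult.commute)
      then have "real n * exp (- q) ^ (n - 1) \<le> real n * (1 / (real n)\<^sup>2)"
        by (intro mult_left_mono) auto
      also have "\<dots> = 1 / real n" using n by (simp add: power2_eq_square)
      finally have "1 - 1 / real n \<le> 1 - real n * exp (- q) ^ (n - 1)" by simp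
      also have "\<dots> \<le> ?p n"
        using prob_cop_number_rgg_ge[where 'd = 'd, of n "r n"] r(1) n
        by (simp add: q_def \<kappa>_def d_def)
      finally show ?thesis .
    qed
    have upper: "?p n \<le> 1" for n
    proof -
      have "prob_space (uniform_measure lborel (cbox (0::real^'d) One))"
        by (rule prob_space_uniform_measure) (simp_all add: emeasure_lborel_cbox_eq)
      then interpret prob_space "rgg_space n :: (nat \<Rightarrow> real ^ 'd) measure"
        unfolding rgg_space_def by (intro prob_space_PiM)
      show ?thesis by (rule prob_le_1)
    qed
    show "?p \<longlonglongrightarrow> 1"
    proof (rule tendsto_sandwich)
      show "(\<lambda>n. 1 - 1 / real n) \<longlonglongrightarrow> 1"
        using tendsto_diff[OF tendsto_const lim_1_over_n, of "1::real"] by simp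
      show "\<forall>\<^sub>F n in sequentially. 1 - 1 / real n \<le> ?p n"
        using lower by (intro eventually_sequentiallyI)
      show "\<forall>\<^sub>F n in sequentially. ?p n \<le> 1" using upper by simp
    qed simp
  qed
qed

end
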